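(* Let $L_1,L_2\ge 1$ be integers and, for $\nu>0$, let $T_{-l_1,l_2}(\nu)$ be the first-passage time from state $-l_1$ to state $l_2$ of the birth-and-death process $(X_t)_{t\ge 0}$ on $\{-L_1,\dots,-1,0,1,\dots,L_2\}$ associated with the complete bipartite interference graph with component sizes $L_1,L_2$ and activation rate $\nu$. Then for any integers $0<l_1\le L_1$ and $0<l_2\le L_2$, $$\mathbb{E}\,T_{-l_1,l_2}(\nu)\sim \frac{L_1+L_2}{L_1L_2}\,\nu^{L_1-1},\qquad \nu\to\infty .$$
   Context: The process $(X_t)_{t\ge0}$ (with parameter $\nu>0$) is the continuous-time Markov birth-and-death process on $\{-L_1,\dots,-1,0,1,\dots,L_2\}$ with transition rates $q(l,l+1)=|l|$ if $-L_1\le l<0$, $q(l,l+1)=(L_2-l)\nu$ if $0\le l<L_2$; $q(l,l-1)=(L_1-|l|)\nu$ if $-L_1<l\le 0$, $q(l,l-1)=l$ if $0<l\le L_2$. (A negative state $-l$ means that $l$ nodes of the first component are active; a positive state $l$ means that $l$ nodes of the second component are active.) For states $a\neq b$, $T_{a,b}(\nu)=\inf\{t>0: X_t=b\}$ given $X_0=a$. The notation $f(\nu)\sim g(\nu)$ means $\lim_{\nu\to\infty}f(\nu)/g(\nu)=1$. *)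

theory Defs
  imports "HOL-Probability.Probability" "HOL-Library.Landau_Symbols"
begin

definition transition_function :: "'s set \<Rightarrow> (real \<Rightarrow> 's \<Rightarrow> 's \<Rightarrow> real) \<Rightarrow> bool" where
  "transition_function S p \<longleftrightarrow>
     (\<forall>t\<ge>0. \<forall>i\<in>S. (\<forall>j\<in>S. 0 \<le> p t i j) \<and> (\<Sum>j\<in>S. p t i j) = 1) \<and>
     (\<forall>i\<in>S. \<forall>j\<in>S. p 0 i j = (if i = j then 1 else 0)) \<and>
     (\<forall>s\<ge>0. \<forall>t\<ge>0. \<forall>i\<in>S. \<forall>k\<in>S. p (s + t) i k = (\<Sum>j\<in>S. p s i j * p t j k))"

text \<open>Only off-diagonal rates are specified. As the rows of \<open>p t\<close> sum to 1 and \<open>S\<close> will be finite,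
  the diagonal of the generator is then minus the total rate out of the state. The values
  \<open>q i i\<close> are never used.\<close>

definition transition_rates ::
    "'s set \<Rightarrow> (real \<Rightarrow> 's \<Rightarrow> 's \<Rightarrow> real) \<Rightarrow> ('s \<Rightarrow> 's \<Rightarrow> real) \<Rightarrow> bool" where
  "transition_rates S p q \<longleftrightarrow>
     (\<forall>i\<in>S. \<forall>j\<in>S. i \<noteq> j \<longrightarrow> ((\<lambda>h. p h i j / h) \<longlongrightarrow> q i j) (at_right 0))"

text \<open>Continuous-time Markov process with finite state space \<open>S\<close>, transition rates \<open>q\<close>,
  right-continuous paths (for the discrete topology on \<open>S\<close>) and initial state \<open>a\<close>.
  The Markov property is stated for events of finitely many past times, multiplied out so that
  conditioning on null events does not arise.\<close>

locale finite_ctmc = prob_space M for M :: "'w measure" +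
  fixes S :: "'s set" and q :: "'s \<Rightarrow> 's \<Rightarrow> real" and X :: "real \<Rightarrow> 'w \<Rightarrow> 's" and a :: 's
  assumes finite_states: "finite S"
    and random_states: "\<And>t. 0 \<le> t \<Longrightarrow> X t \<in> measurable M (count_space S)"
    and right_continuous_paths:
      "\<And>t \<omega>. 0 \<le> t \<Longrightarrow> \<omega> \<in> space M \<Longrightarrow> \<forall>\<^sub>F s in at_right t. X s \<omega> = X t \<omega>"
    and initial_state: "AE \<omega> in M. X 0 \<omega> = a"
    and markov:
      "\<exists>p. transition_function S p \<and> transition_rates S p q \<and>
         (\<forall>(n::nat) (t::nat \<Rightarrow> real) (i::nat \<Rightarrow> 's).
            0 \<le> t 0 \<longrightarrow> (\<forall>k\<le>n. t k \<le> t (Suc k)) \<longrightarrow> (\<forall>k\<le>Suc n. i k \<in> S) \<longrightarrow>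
            prob {\<omega> \<in> space M. \<forall>k\<le>Suc n. X (t k) \<omega> = i k} =
            prob {\<omega> \<in> space M. \<forall>k\<le>n. X (t k) \<omega> = i k} * p (t (Suc n) - t n) (i n) (i (Suc n)))"

text \<open>The infimum is taken in the extended nonnegative reals, so it is \<open>\<infinity>\<close> if \<open>b\<close> is never hit.\<close>

definition first_passage_time :: "(real \<Rightarrow> 'w \<Rightarrow> 's) \<Rightarrow> 's \<Rightarrow> 'w \<Rightarrow> ennreal" where
  "first_passage_time X b \<omega> = (INF t\<in>{t. 0 < t \<and> X t \<omega> = b}. ennreal t)"

text \<open>Right-continuity of the paths makes the first-passage time a random variable, so its
  nonnegative integral is its expectation.\<close>

lemma (in finite_ctmc) first_passage_time_measurable:
  "first_passage_time X b \<in> borel_measurable M"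
proof (rule borel_measurableI_less)
  fix c :: ennreal
  have hit: "{\<omega> \<in> space M. X t \<omega> = b} \<in> sets M" if "0 \<le> t" for t
  proof -
    have "{\<omega> \<in> space M. X t \<omega> = b} = X t -` ({b} \<inter> S) \<inter> space M"
      using measurable_space[OF random_states[OF that]] by auto
    then show ?thesis
      using measurable_sets[OF random_states[OF that], of "{b} \<inter> S"] by simp
  qed
  have "{\<omega> \<in> space M. first_passage_time X b \<omega> < c} =
      (\<Union>r\<in>{r\<in>\<rat>. 0 < r \<and> ennreal r < c}. {\<omega> \<in> space M. X r \<omega> = b})" (is "?A = ?B")
  proof (intro equalityI subsetI)
    fix \<omega> assume "\<omega> \<in> ?A"
    then obtain t where \<omega>: "\<omega> \<in> space M" and t: "0 < t" "X t \<omega> = b" "ennreal t < c"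
      by (auto simp: first_passage_time_def INF_less_iff)
    have "\<forall>\<^sub>F s in at_right t. X s \<omega> = X t \<omega>"
      using right_continuous_paths t(1) \<omega> by simp
    moreover have "\<forall>\<^sub>F s in at_right t. ennreal s < c"
    proof -
      have "((\<lambda>s. ennreal s) \<longlongrightarrow> ennreal t) (at_right t)"
        by (intro tendsto_ennrealI tendsto_ident_at)
      then show ?thesis using t(3) by (rule order_tendstoD)
    qed
    ultimately have "\<forall>\<^sub>F s in at_right t. X s \<omega> = X t \<omega> \<and> ennreal s < c"
      by (rule eventually_conj)
    then obtain u where u: "t < u" "\<And>s. t < s \<Longrightarrow> s < u \<Longrightarrow> X s \<omega> = X t \<omega> \<and> ennreal s < c"
      unfolding eventually_at_right_field by blast
    obtain r where "r \<in> \<rat>" "t < r" "r < u" using Rats_dense_in_real[OF u(1)] by blast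
    then show "\<omega> \<in> ?B" using u(2)[of r] t \<omega> by auto
  next
    fix \<omega> assume "\<omega> \<in> ?B"
    then show "\<omega> \<in> ?A" by (auto simp: first_passage_time_def INF_less_iff)
  qed
  moreover have "?B \<in> sets M"
    using countable_rat
    by (intro sets.countable_UN') (auto intro: countable_subset[OF _ countable_rat] intro!: hit)
  ultimately show "?A \<in> sets M" by simp
qed

text \<open>A state \<open>l < 0\<close> means that \<open>-l\<close> nodes of the first component (of size \<open>L1\<close>) are active,
  a state \<open>l > 0\<close> that \<open>l\<close> nodes of the second component (of size \<open>L2\<close>) are active.\<close>

definition bipartite_states :: "nat \<Rightarrow> nat \<Rightarrow> int set" where
  "bipartite_states L1 L2 = {- int L1..int L2}"

definition bipartite_rate :: "nat \<Rightarrow> nat \<Rightarrow> real \<Rightarrow> int \<Rightarrow> int \<Rightarrow> real" where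
  "bipartite_rate L1 L2 \<nu> l m =
     (if m = l + 1 \<and> - int L1 \<le> l \<and> l < 0 then \<bar>real_of_int l\<bar>
      else if m = l + 1 \<and> 0 \<le> l \<and> l < int L2 then (real L2 - real_of_int l) * \<nu>
      else if m = l - 1 \<and> - int L1 < l \<and> l \<le> 0 then (real L1 - \<bar>real_of_int l\<bar>) * \<nu>
      else if m = l - 1 \<and> 0 < l \<and> l \<le> int L2 then real_of_int l
      else 0)"

end

theory Submission
  imports Defs
begin

text \<open>Mean first-passage times of a Markov chain solve a Poisson equation: if \<open>h \<ge> 0\<close> vanishes at the
target and the generator maps \<open>h\<close> to \<open>-1\<close> at all other states, then \<open>h\<close> of the initial state is the
mean passage time (\<open>finite_ctmc.expected_first_passage_time\<close>). The process is specified through its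
finite-dimensional distributions and right-continuity of its paths, so this is proved by observing
it on the grid of multiples of a small \<open>\<delta>\<close>. Up to the first grid time at the target, \<open>h\<close> decreases
in mean by \<open>\<delta>\<close> per step, up to a relative error that vanishes with \<open>\<delta>\<close>; telescoping
(\<open>drift_telescoping\<close>) turns this into the mean grid passage time. Along dyadic grids these times
decrease to the true first-passage time because the paths are right-continuous, and monotone
convergence finishes the argument.

For a birth-and-death chain with reversible weights \<open>\<pi>\<close> the Poisson equation has an explicit solution
(\<open>birth_death_mean_passage_poisson\<close>): the mean time to go from \<open>k\<close> to \<open>k + 1\<close> is
\<open>(\<Sum>m\<le>k. \<pi> m) / (q(k, k+1) * \<pi> k)\<close>. In the bipartite model \<open>\<pi> k\<close> is a binomial coefficient times
\<open>\<nu>\<close> to the number of active nodes, so up to each state between \<open>-L1\<close> and \<open>0\<close> the sum is dominated by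
the fully active first component, of weight \<open>\<nu> ^ L1\<close>. Only two of the steps from \<open>-l1\<close> to \<open>l2\<close> have a
duration of the top order \<open>\<nu> ^ (L1 - 1)\<close> (\<open>one_step_passage_limit\<close>): the step from \<open>-1\<close> to \<open>0\<close>, where
the last active node of the first component must switch off, with constant \<open>1 / L1\<close>, and the step
from \<open>0\<close> to \<open>1\<close>, where the second component must win the race for the empty network, with constant
\<open>1 / L2\<close>. The two constants add up to \<open>(L1 + L2) / (L1 * L2)\<close>.\<close>

section \<open>Mean first-passage times of finite Markov chains\<close>

text \<open>\<open>N n\<close> stands for the probability of not having hit the target within \<open>n\<close> grid steps, and \<open>H n\<close> for
the mean of \<open>h\<close> at step \<open>n\<close> on that event. The bound \<open>H n \<le> C * N n\<close> makes the remainder of the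
telescoping sum vanish: nonnegativity of \<open>H\<close> alone bounds the partial sums of \<open>N\<close>, so \<open>N\<close>, and with
it \<open>H\<close>, tends to 0.\<close>

lemma drift_telescoping:
  fixes N H :: "nat \<Rightarrow> real"
  assumes "0 < \<delta>" "\<epsilon> < 1"
    and N: "\<And>n. 0 \<le> N n"
    and H: "\<And>n. 0 \<le> H n" "\<And>n. H n \<le> C * N n"
    and drift: "\<And>n. \<bar>H (Suc n) - H n + \<delta> * N n\<bar> \<le> \<epsilon> * \<delta> * N n"
  shows "summable N" "\<bar>\<delta> * (\<Sum>n. N n) - H 0\<bar> \<le> \<epsilon> * (\<delta> * (\<Sum>n. N n))"
proof -
  have partial: "\<bar>H n - H 0 + \<delta> * (\<Sum>k<n. N k)\<bar> \<le> \<epsilon> * (\<delta> * (\<Sum>k<n. N k))" for n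
  proof (induction n)
    case (Suc n)
    show ?case using Suc drift[of n] by (simp add: algebra_simps abs_le_iff)
  qed simp
  have bound: "(\<Sum>k<n. N k) \<le> H 0 / ((1 - \<epsilon>) * \<delta>)" for n
  proof -
    have "(1 - \<epsilon>) * \<delta> * (\<Sum>k<n. N k) \<le> H 0"
      using partial[of n] H(1)[of n] by (simp add: algebra_simps abs_le_iff)
    then show ?thesis using assms(1,2) by (simp add: field_simps)
  qed
  show sm: "summable N"
    by (rule bounded_imp_summable[OF N]) (use bound in \<open>simp only: lessThan_Suc_atMost[symmetric]\<close>)
  have "N \<longlonglongrightarrow> 0" using sm by (rule summable_LIMSEQ_zero)
  then have "(\<lambda>n. C * N n) \<longlonglongrightarrow> C * 0" by (intro tendsto_intros)
  then have "H \<longlonglongrightarrow> 0"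
    by (intro tendsto_sandwich[of "\<lambda>_. 0" H sequentially "\<lambda>n. C * N n"]) (auto simp: H)
  then have "(\<lambda>n. \<bar>H n - H 0 + \<delta> * (\<Sum>k<n. N k)\<bar>) \<longlonglongrightarrow> \<bar>0 - H 0 + \<delta> * (\<Sum>n. N n)\<bar>"
    by (intro tendsto_intros summable_LIMSEQ sm)
  moreover have "(\<lambda>n. \<epsilon> * (\<delta> * (\<Sum>k<n. N k))) \<longlonglongrightarrow> \<epsilon> * (\<delta> * (\<Sum>n. N n))"
    by (intro tendsto_intros summable_LIMSEQ sm)
  ultimately have "\<bar>0 - H 0 + \<delta> * (\<Sum>n. N n)\<bar> \<le> \<epsilon> * (\<delta> * (\<Sum>n. N n))"
    by (rule LIMSEQ_le) (use partial in auto)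
  then show "\<bar>\<delta> * (\<Sum>n. N n) - H 0\<bar> \<le> \<epsilon> * (\<delta> * (\<Sum>n. N n))" by simp
qed

text \<open>Since the rows of \<open>p \<delta>\<close> sum to 1, the mean increment of \<open>h\<close> only involves the off-diagonal entries,
which are the ones that the transition rates describe.\<close>

lemma generator_drift:
  fixes p :: "real \<Rightarrow> 's \<Rightarrow> 's \<Rightarrow> real"
  assumes "finite S" "transition_function S p" "transition_rates S p q" "i \<in> S" "0 < \<epsilon>"
  shows "\<forall>\<^sub>F \<delta> in at_right 0.
    \<bar>(\<Sum>j\<in>S. p \<delta> i j * h j) - h i - \<delta> * (\<Sum>j\<in>S - {i}. q i j * (h j - h i))\<bar> \<le> \<epsilon> * \<delta>"
proof -
  let ?g = "\<Sum>j\<in>S - {i}. q i j * (h j - h i)"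
  have "((\<lambda>\<delta>. \<Sum>j\<in>S - {i}. p \<delta> i j / \<delta> * (h j - h i)) \<longlongrightarrow> ?g) (at_right 0)"
    using assms(3,4) unfolding transition_rates_def
    by (intro tendsto_sum tendsto_mult tendsto_const) auto
  then have "\<forall>\<^sub>F \<delta> in at_right 0. dist (\<Sum>j\<in>S - {i}. p \<delta> i j / \<delta> * (h j - h i)) ?g < \<epsilon>"
    using assms(5) by (rule tendstoD)
  moreover have "\<forall>\<^sub>F \<delta> in at_right 0. (0::real) < \<delta>" by (simp add: eventually_at_right_less)
  ultimately show ?thesis
  proof eventually_elim
    case (elim \<delta>)
    have 1: "(\<Sum>j\<in>S. p \<delta> i j) = 1"
      using assms(2,4) elim(2) unfolding transition_function_def by simp
    have "(\<Sum>j\<in>S. p \<delta> i j * h j) - h i = (\<Sum>j\<in>S. p \<delta> i j * h j) - (\<Sum>j\<in>S. p \<delta> i j) * h i"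
      using 1 by simp
    also have "\<dots> = (\<Sum>j\<in>S. p \<delta> i j * (h j - h i))"
      by (simp add: sum_distrib_right right_diff_distrib sum_subtractf)
    also have "\<dots> = (\<Sum>j\<in>S - {i}. p \<delta> i j * (h j - h i))"
      using assms(1,4) by (simp add: sum.remove)
    also have "\<dots> = \<delta> * (\<Sum>j\<in>S - {i}. p \<delta> i j / \<delta> * (h j - h i))"
      using elim(2) by (simp add: sum_distrib_left)
    finally have "\<bar>(\<Sum>j\<in>S. p \<delta> i j * h j) - h i - \<delta> * ?g\<bar> =
        \<bar>\<delta> * ((\<Sum>j\<in>S - {i}. p \<delta> i j / \<delta> * (h j - h i)) - ?g)\<bar>"
      by (simp add: right_diff_distrib)
    also have "\<dots> \<le> \<delta> * \<epsilon>"
      using elim by (simp add: abs_mult dist_real_def)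
    finally show ?case by (simp add: mult.commute)
  qed
qed

context finite_ctmc
begin

definition grid_survival :: "'s \<Rightarrow> real \<Rightarrow> nat \<Rightarrow> 'w set" where
  "grid_survival b \<delta> n = {\<omega> \<in> space M. \<forall>k\<le>n. X (real k * \<delta>) \<omega> \<noteq> b}"

text \<open>The index 0 is included, so that the grid passage time is \<open>\<delta>\<close> times the number of \<open>n\<close> for which the
path survives the first \<open>n\<close> steps. On paths that do not start at the target, only positive times
enter the infimum.\<close>

definition grid_passage_time :: "'s \<Rightarrow> real \<Rightarrow> 'w \<Rightarrow> ennreal" where
  "grid_passage_time b \<delta> \<omega> = (INF k\<in>{k. X (real k * \<delta>) \<omega> = b}. ennreal (real k * \<delta>))"

lemma state_in: "0 \<le> t \<Longrightarrow> \<omega> \<in> space M \<Longrightarrow> X t \<omega> \<in> S"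
  using measurable_space[OF random_states] by auto

lemma state_event: "0 \<le> t \<Longrightarrow> {\<omega> \<in> space M. X t \<omega> = i} \<in> events"
proof -
  assume t: "0 \<le> t"
  have "{\<omega> \<in> space M. X t \<omega> = i} = X t -` ({i} \<inter> S) \<inter> space M"
    using state_in[OF t] by auto
  then show ?thesis
    using measurable_sets[OF random_states[OF t], of "{i} \<inter> S"] by simp
qed

text \<open>The Markov property is available for fully specified histories only; avoiding \<open>b\<close> is a finite
disjoint union of such histories.\<close>

lemma prob_histories:
  fixes t :: "nat \<Rightarrow> real"
  assumes t: "\<And>k. 0 \<le> t k" and D: "D \<in> events"
  shows "prob {\<omega> \<in> D. \<forall>k<n. X (t k) \<omega> \<noteq> b} =
    (\<Sum>c\<in>PiE {..<n} (\<lambda>_. S - {b}). prob {\<omega> \<in> D. \<forall>k<n. X (t k) \<omega> = c k})"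
proof -
  let ?C = "PiE {..<n} (\<lambda>_. S - {b})" and ?E = "\<lambda>c. {\<omega> \<in> D. \<forall>k<n. X (t k) \<omega> = c k}"
  have D_space: "\<omega> \<in> space M" if "\<omega> \<in> D" for \<omega>
    using sets.sets_into_space[OF D] that by auto
  have union: "{\<omega> \<in> D. \<forall>k<n. X (t k) \<omega> \<noteq> b} = (\<Union>c\<in>?C. ?E c)" (is "?A = ?B")
  proof (intro equalityI subsetI)
    fix \<omega> assume "\<omega> \<in> ?A"
    then have "restrict (\<lambda>k. X (t k) \<omega>) {..<n} \<in> ?C" "\<omega> \<in> ?E (restrict (\<lambda>k. X (t k) \<omega>) {..<n})"
      using state_in[OF t D_space] by auto
    then show "\<omega> \<in> ?B" by blast
  next
    fix \<omega> assume "\<omega> \<in> ?B"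
    then show "\<omega> \<in> ?A" by (auto simp: PiE_iff)
  qed
  have "?E c \<in> events" for c
  proof -
    have "?E c = D \<inter> {\<omega> \<in> space M. \<forall>k<n. X (t k) \<omega> = c k}" using D_space by auto
    also have "\<dots> \<in> events"
      by (intro sets.Int D sets.sets_Collect_countable_All sets.sets_Collect_imp
        sets.sets_Collect_const state_event t)
    finally show ?thesis .
  qed
  then have ev: "?E ` ?C \<subseteq> events" by blast
  have disj: "disjoint_family_on ?E ?C"
  proof (unfold disjoint_family_on_def, intro ballI impI)
    fix c c' assume c: "c \<in> ?C" "c' \<in> ?C" "c \<noteq> c'"
    then obtain k where "k < n" "c k \<noteq> c' k"
      by (meson PiE_ext lessThan_iff)
    then show "?E c \<inter> ?E c' = {}" by auto
  qed
  have "finite ?C" using finite_states by (intro finite_PiE) auto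
  then show ?thesis unfolding union using ev disj by (rule finite_measure_finite_Union)
qed

text \<open>The Markov property with the event of not having hit \<open>b\<close> as the past. As \<open>i \<noteq> b\<close>, survival up to \<open>n\<close>
only constrains the times before \<open>n\<close>, so the histories to sum over have length \<open>n\<close>.\<close>

lemma grid_survival_step:
  assumes p: "\<And>(n::nat) (t::nat \<Rightarrow> real) (i::nat \<Rightarrow> 's).
      0 \<le> t 0 \<Longrightarrow> (\<forall>k\<le>n. t k \<le> t (Suc k)) \<Longrightarrow> (\<forall>k\<le>Suc n. i k \<in> S) \<Longrightarrow>
      prob {\<omega> \<in> space M. \<forall>k\<le>Suc n. X (t k) \<omega> = i k} =
      prob {\<omega> \<in> space M. \<forall>k\<le>n. X (t k) \<omega> = i k} * p (t (Suc n) - t n) (i n) (i (Suc n))"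
    and \<delta>: "0 \<le> \<delta>" and i: "i \<in> S" "i \<noteq> b" and j: "j \<in> S"
  shows "prob {\<omega> \<in> grid_survival b \<delta> n. X (real n * \<delta>) \<omega> = i \<and> X (real (Suc n) * \<delta>) \<omega> = j} =
    prob {\<omega> \<in> grid_survival b \<delta> n. X (real n * \<delta>) \<omega> = i} * p \<delta> i j"
proof -
  let ?t = "\<lambda>k. real k * \<delta>" and ?C = "PiE {..<n} (\<lambda>_. S - {b})"
  let ?D = "{\<omega> \<in> space M. X (?t n) \<omega> = i}"
  let ?D' = "{\<omega> \<in> space M. X (?t n) \<omega> = i \<and> X (?t (Suc n)) \<omega> = j}"
  have t: "0 \<le> ?t k" for k using \<delta> by simp
  have D: "?D \<in> events" using t by (rule state_event)
  have D': "?D' \<in> events"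
    by (intro sets.sets_Collect_conj state_event t)
  have le_iff: "k \<le> n \<longleftrightarrow> k < n \<or> k = n" for k by auto
  have "{\<omega> \<in> grid_survival b \<delta> n. X (?t n) \<omega> = i \<and> X (?t (Suc n)) \<omega> = j} =
      {\<omega> \<in> ?D'. \<forall>k<n. X (?t k) \<omega> \<noteq> b}"
    using i by (auto simp: grid_survival_def le_iff)
  then have "prob {\<omega> \<in> grid_survival b \<delta> n. X (?t n) \<omega> = i \<and> X (?t (Suc n)) \<omega> = j} =
      (\<Sum>c\<in>?C. prob {\<omega> \<in> ?D'. \<forall>k<n. X (?t k) \<omega> = c k})"
    using prob_histories[of ?t, OF t D', of n b] by simp
  also have "\<dots> = (\<Sum>c\<in>?C. prob {\<omega> \<in> ?D. \<forall>k<n. X (?t k) \<omega> = c k} * p \<delta> i j)"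
  proof (rule sum.cong[OF refl])
    fix c assume c: "c \<in> ?C"
    let ?c = "c(n := i, Suc n := j)"
    have "prob {\<omega> \<in> space M. \<forall>k\<le>Suc n. X (?t k) \<omega> = ?c k} =
        prob {\<omega> \<in> space M. \<forall>k\<le>n. X (?t k) \<omega> = ?c k} * p (?t (Suc n) - ?t n) (?c n) (?c (Suc n))"
      using c i j \<delta> by (intro p) (auto simp: PiE_iff algebra_simps le_Suc_eq le_iff)
    moreover have "?t (Suc n) - ?t n = \<delta>" by (simp add: algebra_simps)
    moreover have "{\<omega> \<in> space M. \<forall>k\<le>Suc n. X (?t k) \<omega> = ?c k} =
        {\<omega> \<in> ?D'. \<forall>k<n. X (?t k) \<omega> = c k}"
      by (auto simp: le_Suc_eq le_iff)
    moreover have "{\<omega> \<in> space M. \<forall>k\<le>n. X (?t k) \<omega> = ?c k} =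
        {\<omega> \<in> ?D. \<forall>k<n. X (?t k) \<omega> = c k}"
      by (auto simp: le_iff)
    ultimately show "prob {\<omega> \<in> ?D'. \<forall>k<n. X (?t k) \<omega> = c k} =
        prob {\<omega> \<in> ?D. \<forall>k<n. X (?t k) \<omega> = c k} * p \<delta> i j"
      by simp
  qed
  also have "\<dots> = prob {\<omega> \<in> ?D. \<forall>k<n. X (?t k) \<omega> \<noteq> b} * p \<delta> i j"
    by (subst prob_histories[of ?t, OF t D]) (simp add: sum_distrib_right)
  also have "{\<omega> \<in> ?D. \<forall>k<n. X (?t k) \<omega> \<noteq> b} = {\<omega> \<in> grid_survival b \<delta> n. X (?t n) \<omega> = i}"
    using i by (auto simp: grid_survival_def le_iff)
  finally show ?thesis .
qed

lemma grid_survival_Suc: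
  "grid_survival b \<delta> (Suc n) = {\<omega> \<in> grid_survival b \<delta> n. X (real (Suc n) * \<delta>) \<omega> \<noteq> b}"
  unfolding grid_survival_def le_Suc_eq by blast

lemma grid_survival_event:
  assumes "0 \<le> \<delta>"
  shows "grid_survival b \<delta> n \<in> events"
proof -
  have "{\<omega> \<in> space M. X (real k * \<delta>) \<omega> \<noteq> b} \<in> events" for k
    using assms by (intro sets.sets_Collect_neg[OF state_event]) simp
  then show ?thesis
    unfolding grid_survival_def
    by (intro sets.sets_Collect_countable_All sets.sets_Collect_imp sets.sets_Collect_const)
qed

lemma grid_passage_time_eq_suminf:
  assumes \<delta>: "0 < \<delta>" and \<omega>: "\<omega> \<in> space M"
  shows "grid_passage_time b \<delta> \<omega> = (\<Sum>n. ennreal \<delta> * indicator (grid_survival b \<delta> n) \<omega>)"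
proof (cases "\<exists>k. X (real k * \<delta>) \<omega> = b")
  case True
  define m where "m = (LEAST k. X (real k * \<delta>) \<omega> = b)"
  have m: "X (real m * \<delta>) \<omega> = b" unfolding m_def using True by (rule LeastI_ex)
  have least: "m \<le> k" if "X (real k * \<delta>) \<omega> = b" for k
    unfolding m_def using that by (rule Least_le)
  have "\<omega> \<in> grid_survival b \<delta> n \<longleftrightarrow> n < m" for n
    using m least \<omega> by (fastforce simp: grid_survival_def not_le)
  then have "(\<Sum>n. ennreal \<delta> * indicator (grid_survival b \<delta> n) \<omega>) =
      (\<Sum>n<m. ennreal \<delta> * indicator (grid_survival b \<delta> n) \<omega>)"
    by (intro suminf_finite) auto
  also have "\<dots> = (\<Sum>n<m. ennreal \<delta>)"
    using \<open>\<And>n. \<omega> \<in> grid_survival b \<delta> n \<longleftrightarrow> n < m\<close> by (intro sum.cong) auto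
  also have "\<dots> = ennreal (real m * \<delta>)"
    using \<delta> by (simp add: ennreal_mult' ennreal_of_nat_eq_real_of_nat)
  also have "\<dots> = grid_passage_time b \<delta> \<omega>"
    unfolding grid_passage_time_def using \<delta> m least
    by (intro antisym INF_greatest INF_lower) (auto intro!: ennreal_leI mult_right_mono)
  finally show ?thesis by simp
next
  case False
  have "(\<Sum>n. ennreal \<delta>) = \<top>"
  proof (rule ccontr)
    assume "(\<Sum>n::nat. ennreal \<delta>) \<noteq> \<top>"
    then have "summable (\<lambda>_::nat. \<delta>)"
      using \<delta> by (intro summable_suminf_not_top) auto
    then have "(\<lambda>_::nat. \<delta>) \<longlonglongrightarrow> 0" by (rule summable_LIMSEQ_zero)
    then show False using \<delta> by (simp add: LIMSEQ_const_iff)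
  qed
  then show ?thesis
    using False \<omega> by (simp add: grid_passage_time_def grid_survival_def)
qed

lemma grid_passage_time_measurable:
  assumes \<delta>: "0 < \<delta>"
  shows "grid_passage_time b \<delta> \<in> borel_measurable M"
proof -
  have [measurable]: "grid_survival b \<delta> n \<in> events" for n
    using \<delta> by (intro grid_survival_event) simp
  have "(\<lambda>\<omega>. \<Sum>n. ennreal \<delta> * indicator (grid_survival b \<delta> n) \<omega>) \<in> borel_measurable M"
    by measurable
  then show ?thesis
    by (rule measurable_cong[THEN iffD1, rotated]) (simp add: grid_passage_time_eq_suminf[OF \<delta>])
qed

lemma expected_grid_passage_time:
  assumes \<delta>: "0 < \<delta>" and sm: "summable (\<lambda>n. prob (grid_survival b \<delta> n))"
  shows "(\<integral>\<^sup>+ \<omega>. grid_passage_time b \<delta> \<omega> \<partial>M) = ennreal (\<delta> * (\<Sum>n. prob (grid_survival b \<delta> n)))"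
proof -
  have ev: "grid_survival b \<delta> n \<in> events" for n using \<delta> by (intro grid_survival_event) simp
  have "(\<integral>\<^sup>+ \<omega>. grid_passage_time b \<delta> \<omega> \<partial>M) =
      (\<integral>\<^sup>+ \<omega>. (\<Sum>n. ennreal \<delta> * indicator (grid_survival b \<delta> n) \<omega>) \<partial>M)"
    by (intro nn_integral_cong grid_passage_time_eq_suminf \<delta>)
  also have "\<dots> = (\<Sum>n. \<integral>\<^sup>+ \<omega>. ennreal \<delta> * indicator (grid_survival b \<delta> n) \<omega> \<partial>M)"
    using ev by (intro nn_integral_suminf) auto
  also have "\<dots> = (\<Sum>n. ennreal (\<delta> * prob (grid_survival b \<delta> n)))"
    using ev \<delta> by (simp add: nn_integral_cmult_indicator emeasure_eq_measure ennreal_mult)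
  also have "\<dots> = ennreal (\<Sum>n. \<delta> * prob (grid_survival b \<delta> n))"
    using \<delta> by (intro suminf_ennreal2 summable_mult sm) auto
  finally show ?thesis using sm by (simp add: suminf_mult)
qed

lemma grid_passage_time_refine:
  "grid_passage_time b (\<delta> / 2) \<omega> \<le> grid_passage_time b \<delta> \<omega>"
  unfolding grid_passage_time_def
proof (rule INF_mono)
  fix k assume "k \<in> {k. X (real k * \<delta>) \<omega> = b}"
  then show "\<exists>k'\<in>{k. X (real k * (\<delta> / 2)) \<omega> = b}. ennreal (real k' * (\<delta> / 2)) \<le> ennreal (real k * \<delta>)"
    by (intro bexI[of _ "2 * k"]) auto
qed

text \<open>Right-continuity keeps the path at \<open>b\<close> for a short while after each visit, and a fine enough grid
has a point in that interval. The offset \<open>m0\<close> permits the coarse grids, where the mean passage time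
might not be known to be finite, to be skipped.\<close>

lemma first_passage_time_eq_INF_grid:
  assumes \<omega>: "\<omega> \<in> space M" and start: "X 0 \<omega> \<noteq> b"
  shows "first_passage_time X b \<omega> = (INF m. grid_passage_time b (1 / 2 ^ (m + m0)) \<omega>)"
proof (rule antisym)
  show "first_passage_time X b \<omega> \<le> (INF m. grid_passage_time b (1 / 2 ^ (m + m0)) \<omega>)"
    unfolding grid_passage_time_def
  proof (intro INF_greatest)
    fix m k assume "k \<in> {k. X (real k * (1 / 2 ^ (m + m0))) \<omega> = b}"
    moreover from this have "k \<noteq> 0" by (rule contrapos_pn) (use start in simp)
    ultimately show "first_passage_time X b \<omega> \<le> ennreal (real k * (1 / 2 ^ (m + m0)))"
      unfolding first_passage_time_def by (intro INF_lower) auto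
  qed
next
  show "(INF m. grid_passage_time b (1 / 2 ^ (m + m0)) \<omega>) \<le> first_passage_time X b \<omega>"
    unfolding first_passage_time_def
  proof (rule INF_greatest, rule ennreal_le_epsilon)
    fix t and e :: real assume t: "t \<in> {t. 0 < t \<and> X t \<omega> = b}" and e: "0 < e"
    then have "X t \<omega> = b" "0 \<le> t" by simp_all
    with right_continuous_paths[OF this(2) \<omega>]
    have "\<forall>\<^sub>F s in at_right t. X s \<omega> = b" by (simp only:)
    then obtain u where u: "t < u" "\<And>s. t < s \<Longrightarrow> s < u \<Longrightarrow> X s \<omega> = b"
      unfolding eventually_at_right_field by blast
    obtain m where m: "(1/2) ^ m < min e (u - t)"
      using real_arch_pow_inv[of "min e (u - t)" "1/2"] e u(1) by auto
    define \<delta> :: real where "\<delta> = 1 / 2 ^ (m + m0)"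
    have "\<delta> \<le> (1/2) ^ m"
      unfolding \<delta>_def by (simp add: power_add power_divide field_simps)
    then have \<delta>: "0 < \<delta>" "\<delta> < e" "\<delta> < u - t" using m by (auto simp: \<delta>_def)
    define k where "k = nat \<lfloor>t / \<delta>\<rfloor> + 1"
    have "real k = of_int \<lfloor>t / \<delta>\<rfloor> + 1" using t \<delta>(1) by (simp add: k_def)
    then have "t / \<delta> < real k" "real k \<le> t / \<delta> + 1" by linarith+
    then have k: "t < real k * \<delta>" "real k * \<delta> \<le> t + \<delta>" using \<delta>(1) by (simp_all add: field_simps)
    have "(INF m. grid_passage_time b (1 / 2 ^ (m + m0)) \<omega>) \<le> grid_passage_time b \<delta> \<omega>"
      unfolding \<delta>_def by (rule INF_lower) simp
    also have "\<dots> \<le> ennreal (real k * \<delta>)"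
      unfolding grid_passage_time_def using u(2)[OF k(1)] k(2) \<delta> by (intro INF_lower) auto
    also have "\<dots> \<le> ennreal (t + e)" using k \<delta> by (intro ennreal_leI) simp
    also have "\<dots> = ennreal t + ennreal e" using t e by (intro ennreal_plus) auto
    finally show "(INF m. grid_passage_time b (1 / 2 ^ (m + m0)) \<omega>) \<le> ennreal t + ennreal e" .
  qed
qed

lemma prob_eq_sum_states:
  assumes "0 \<le> t" and D: "D \<in> events"
  shows "prob D = (\<Sum>i\<in>S. prob {\<omega> \<in> D. X t \<omega> = i})"
proof -
  have *: "{\<omega> \<in> D. X t \<omega> = i} = D \<inter> {\<omega> \<in> space M. X t \<omega> = i}" for i
    using sets.sets_into_space[OF D] by auto
  have "D = (\<Union>i\<in>S. {\<omega> \<in> D. X t \<omega> = i})"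
    using sets.sets_into_space[OF D] state_in[OF assms(1)] by auto
  moreover have "prob (\<Union>i\<in>S. {\<omega> \<in> D. X t \<omega> = i}) = (\<Sum>i\<in>S. prob {\<omega> \<in> D. X t \<omega> = i})"
    using finite_states D state_event[OF assms(1)]
    by (intro finite_measure_finite_Union) (auto simp: disjoint_family_on_def *)
  ultimately show ?thesis by simp
qed

text \<open>The process stopped on hitting \<open>b\<close> along the grid loses, in mean, between \<open>(1 - \<epsilon>) * \<delta>\<close> and
\<open>(1 + \<epsilon>) * \<delta>\<close> of \<open>h\<close> per surviving step, and \<open>h\<close> vanishes where it is stopped. Between grid points
the process may pass through \<open>b\<close> unnoticed, which is why the Poisson equation is required at every
state other than \<open>b\<close>, including those beyond the target.\<close>

lemma expected_grid_passage_time_approx: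
  assumes b: "b \<in> S" "a \<noteq> b"
    and h: "\<And>i. i \<in> S \<Longrightarrow> 0 \<le> h i" "h b = 0"
    and poisson: "\<And>i. i \<in> S \<Longrightarrow> i \<noteq> b \<Longrightarrow> (\<Sum>j\<in>S - {i}. q i j * (h j - h i)) = - 1"
    and \<epsilon>: "0 < \<epsilon>" "\<epsilon> < 1"
  shows "\<forall>\<^sub>F \<delta> in at_right 0. summable (\<lambda>n. prob (grid_survival b \<delta> n)) \<and>
    \<bar>\<delta> * (\<Sum>n. prob (grid_survival b \<delta> n)) - h a\<bar> \<le>
      \<epsilon> * (\<delta> * (\<Sum>n. prob (grid_survival b \<delta> n)))"
proof -
  obtain p where p: "transition_function S p" "transition_rates S p q"
    and fdd: "\<And>(n::nat) (t::nat \<Rightarrow> real) (i::nat \<Rightarrow> 's).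
      0 \<le> t 0 \<Longrightarrow> (\<forall>k\<le>n. t k \<le> t (Suc k)) \<Longrightarrow> (\<forall>k\<le>Suc n. i k \<in> S) \<Longrightarrow>
      prob {\<omega> \<in> space M. \<forall>k\<le>Suc n. X (t k) \<omega> = i k} =
      prob {\<omega> \<in> space M. \<forall>k\<le>n. X (t k) \<omega> = i k} * p (t (Suc n) - t n) (i n) (i (Suc n))"
    using markov by blast
  have "\<forall>\<^sub>F \<delta> in at_right 0. \<forall>i\<in>S - {b}.
      \<bar>(\<Sum>j\<in>S. p \<delta> i j * h j) - h i - \<delta> * (\<Sum>j\<in>S - {i}. q i j * (h j - h i))\<bar> \<le> \<epsilon> * \<delta>"
    using finite_states p \<epsilon> by (intro eventually_ball_finite ballI generator_drift) auto
  moreover have "\<forall>\<^sub>F \<delta> in at_right 0. (0::real) < \<delta>" by (simp add: eventually_at_right_less)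
  ultimately show ?thesis
  proof eventually_elim
    case (elim \<delta>)
    have \<delta>: "0 < \<delta>" by (rule elim(2))
    have step_drift: "\<bar>(\<Sum>j\<in>S. p \<delta> i j * h j) - h i + \<delta>\<bar> \<le> \<epsilon> * \<delta>" if "i \<in> S - {b}" for i
      using elim(1)[rule_format, OF that] poisson[of i] that by simp
    let ?A = "grid_survival b \<delta>"
    let ?f = "\<lambda>n i. prob {\<omega> \<in> ?A n. X (real n * \<delta>) \<omega> = i}"
    \<comment> \<open>As \<open>h b = 0\<close>, \<open>H n\<close> is the mean of \<open>h\<close> under the stopped process after \<open>n\<close> steps.\<close>
    define N where "N n = prob (?A n)" for n
    define H where "H n = (\<Sum>i\<in>S - {b}. ?f n i * h i)" for n
    have ev: "?A n \<in> events" for n using \<delta> by (intro grid_survival_event) simp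
    have N_sum: "N n = (\<Sum>i\<in>S - {b}. ?f n i)" for n
    proof -
      have empty: "{\<omega> \<in> ?A n. X (real n * \<delta>) \<omega> = b} = {}" by (auto simp: grid_survival_def)
      have "?f n b = 0" unfolding empty by simp
      moreover have "prob (?A n) = (\<Sum>i\<in>S. ?f n i)"
        using \<delta> by (intro prob_eq_sum_states ev) simp
      ultimately show ?thesis
        unfolding N_def using b finite_states by (simp add: sum.remove)
    qed
    have f_Suc: "?f (Suc n) j = (\<Sum>i\<in>S - {b}. ?f n i * p \<delta> i j)" if j: "j \<in> S - {b}" for n j
    proof -
      have surv: "{\<omega> \<in> ?A (Suc n). X (real (Suc n) * \<delta>) \<omega> = j} =
          {\<omega> \<in> ?A n. X (real (Suc n) * \<delta>) \<omega> = j}"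
        using j unfolding grid_survival_Suc by blast
      have "{\<omega> \<in> ?A n. X (real (Suc n) * \<delta>) \<omega> = j} =
          ?A n \<inter> {\<omega> \<in> space M. X (real (Suc n) * \<delta>) \<omega> = j}"
        by (auto simp: grid_survival_def)
      then have ev': "{\<omega> \<in> ?A n. X (real (Suc n) * \<delta>) \<omega> = j} \<in> events"
        using ev \<delta> state_event[of "real (Suc n) * \<delta>" j] by (simp add: sets.Int)
      have "?f (Suc n) j = (\<Sum>i\<in>S. prob {\<omega> \<in> {\<omega> \<in> ?A n. X (real (Suc n) * \<delta>) \<omega> = j}. X (real n * \<delta>) \<omega> = i})"
        unfolding surv using \<delta> by (intro prob_eq_sum_states ev') simp
      also have "\<dots> = (\<Sum>i\<in>S. prob {\<omega> \<in> ?A n. X (real n * \<delta>) \<omega> = i \<and> X (real (Suc n) * \<delta>) \<omega> = j})"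
        by (intro sum.cong refl arg_cong[of _ _ prob]) auto
      also have "\<dots> = (\<Sum>i\<in>S - {b}. prob {\<omega> \<in> ?A n. X (real n * \<delta>) \<omega> = i \<and> X (real (Suc n) * \<delta>) \<omega> = j})"
      proof -
        have empty: "{\<omega> \<in> ?A n. X (real n * \<delta>) \<omega> = b \<and> X (real (Suc n) * \<delta>) \<omega> = j} = {}"
          by (auto simp: grid_survival_def)
        have "prob {\<omega> \<in> ?A n. X (real n * \<delta>) \<omega> = b \<and> X (real (Suc n) * \<delta>) \<omega> = j} = 0"
          unfolding empty by simp
        then show ?thesis using b finite_states by (simp add: sum.remove)
      qed
      also have "\<dots> = (\<Sum>i\<in>S - {b}. ?f n i * p \<delta> i j)"
        using \<delta> j by (intro sum.cong refl grid_survival_step fdd) auto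
      finally show ?thesis .
    qed
    have H_Suc: "H (Suc n) = (\<Sum>i\<in>S - {b}. ?f n i * (\<Sum>j\<in>S. p \<delta> i j * h j))" for n
    proof -
      have "H (Suc n) = (\<Sum>j\<in>S - {b}. \<Sum>i\<in>S - {b}. ?f n i * p \<delta> i j * h j)"
        unfolding H_def by (intro sum.cong refl) (simp only: f_Suc sum_distrib_right)
      also have "\<dots> = (\<Sum>i\<in>S - {b}. ?f n i * (\<Sum>j\<in>S - {b}. p \<delta> i j * h j))"
        by (subst sum.swap) (simp add: sum_distrib_left mult.assoc)
      also have "\<dots> = (\<Sum>i\<in>S - {b}. ?f n i * (\<Sum>j\<in>S. p \<delta> i j * h j))"
        using b finite_states h(2) by (simp add: sum.remove)
      finally show ?thesis .
    qed
    have "\<bar>H (Suc n) - H n + \<delta> * N n\<bar> \<le> \<epsilon> * \<delta> * N n" for n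
    proof -
      have "H (Suc n) - H n + \<delta> * N n =
          (\<Sum>i\<in>S - {b}. ?f n i * ((\<Sum>j\<in>S. p \<delta> i j * h j) - h i + \<delta>))"
        unfolding H_Suc N_sum unfolding H_def
        by (simp add: algebra_simps sum.distrib sum_subtractf sum_distrib_left)
      also have "\<bar>\<dots>\<bar> \<le> (\<Sum>i\<in>S - {b}. \<bar>?f n i * ((\<Sum>j\<in>S. p \<delta> i j * h j) - h i + \<delta>)\<bar>)"
        by (rule sum_abs)
      also have "\<dots> \<le> (\<Sum>i\<in>S - {b}. ?f n i * (\<epsilon> * \<delta>))"
      proof (rule sum_mono)
        fix i assume "i \<in> S - {b}"
        from mult_left_mono[OF step_drift[OF this], of "?f n i"]
        show "\<bar>?f n i * ((\<Sum>j\<in>S. p \<delta> i j * h j) - h i + \<delta>)\<bar> \<le> ?f n i * (\<epsilon> * \<delta>)"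
          by (simp only: abs_mult abs_of_nonneg[OF measure_nonneg] measure_nonneg)
      qed
      also have "\<dots> = \<epsilon> * \<delta> * N n"
        unfolding N_sum by (simp add: sum_distrib_left mult.commute)
      finally show ?thesis .
    qed
    moreover have "0 \<le> H n" for n
      unfolding H_def using h(1) by (intro sum_nonneg) auto
    moreover have "H n \<le> (\<Sum>i\<in>S. h i) * N n" for n
    proof -
      have "h i \<le> (\<Sum>i\<in>S. h i)" if "i \<in> S" for i
        using finite_states h(1) that by (intro member_le_sum) auto
      then show ?thesis
        unfolding H_def N_sum sum_distrib_left
        by (intro sum_mono) (auto simp: mult.commute[of "sum h S"] intro: mult_left_mono)
    qed
    moreover have "0 \<le> N n" for n by (simp add: N_def)
    ultimately have *: "summable N" "\<bar>\<delta> * (\<Sum>n. N n) - H 0\<bar> \<le> \<epsilon> * (\<delta> * (\<Sum>n. N n))"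
      using drift_telescoping[of \<delta> \<epsilon> N H "\<Sum>i\<in>S. h i"] \<delta> \<epsilon> by auto
    have start: "AE \<omega> in M. \<omega> \<in> {\<omega> \<in> ?A 0. X (real 0 * \<delta>) \<omega> = i} \<longleftrightarrow> \<omega> \<in> (if i = a then space M else {})" for i
      using initial_state AE_space by eventually_elim (use b in \<open>auto simp: grid_survival_def\<close>)
    have "?f 0 i = (if i = a then 1 else 0)" for i
    proof -
      have "{\<omega> \<in> ?A 0. X (real 0 * \<delta>) \<omega> = i} = ?A 0 \<inter> {\<omega> \<in> space M. X 0 \<omega> = i}"
        by (auto simp: grid_survival_def)
      then have "{\<omega> \<in> ?A 0. X (real 0 * \<delta>) \<omega> = i} \<in> events"
        using ev state_event[of 0 i] by (simp add: sets.Int)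
      then have "?f 0 i = prob (if i = a then space M else {})"
        by (intro finite_measure_eq_AE start) auto
      then show ?thesis by (simp add: prob_space)
    qed
    moreover have "a \<in> S"
    proof -
      have "AE \<omega> in M. a \<in> S"
        using initial_state AE_space by eventually_elim (use state_in[of 0] in auto)
      then show ?thesis by simp
    qed
    ultimately have "H 0 = h a"
      unfolding H_def using b finite_states by (simp add: if_distrib[of "\<lambda>x. x * _"] sum.delta cong: if_cong)
    then show ?case using * by (simp add: N_def[abs_def])
  qed
qed

text \<open>The dyadic grid passage times decrease to the first-passage time and their means tend to \<open>h a\<close>, so
monotone convergence identifies the mean of the limit.\<close>

theorem expected_first_passage_time:
  assumes b: "b \<in> S" "a \<noteq> b"
    and h: "\<And>i. i \<in> S \<Longrightarrow> 0 \<le> h i" "h b = 0"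
    and poisson: "\<And>i. i \<in> S \<Longrightarrow> i \<noteq> b \<Longrightarrow> (\<Sum>j\<in>S - {i}. q i j * (h j - h i)) = - 1"
  shows "(\<integral>\<^sup>+ \<omega>. first_passage_time X b \<omega> \<partial>M) = ennreal (h a)"
proof -
  define \<delta> :: "nat \<Rightarrow> real" where "\<delta> m = 1 / 2 ^ m" for m
  define s where "s m = \<delta> m * (\<Sum>n. prob (grid_survival b (\<delta> m) n))" for m
  have \<delta>_pos: "0 < \<delta> m" for m by (simp add: \<delta>_def)
  have "\<delta> \<longlonglongrightarrow> 0"
    unfolding \<delta>_def using LIMSEQ_inverse_realpow_zero[of 2] by (simp add: divide_inverse)
  then have "filterlim \<delta> (at_right 0) sequentially"
    using \<delta>_pos unfolding filterlim_at by (auto simp: less_imp_neq[symmetric] intro!: always_eventually)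
  then have approx: "\<forall>\<^sub>F m in sequentially. summable (\<lambda>n. prob (grid_survival b (\<delta> m) n)) \<and>
      \<bar>s m - h a\<bar> \<le> \<epsilon> * s m" if "0 < \<epsilon>" "\<epsilon> < 1" for \<epsilon>
    unfolding s_def
    using expected_grid_passage_time_approx[OF b h poisson that] by (rule filterlim_iff[THEN iffD1, rule_format])
  have lim: "s \<longlonglongrightarrow> h a"
  proof (rule tendstoI)
    fix e :: real assume e: "0 < e"
    \<comment> \<open>\<open>\<epsilon> \<le> 1/2\<close> gives \<open>s m \<le> 2 * (\<bar>h a\<bar> + 1)\<close>, so that the relative error \<open>\<epsilon>\<close> becomes an absolute one.\<close>
    define \<epsilon> where "\<epsilon> = min (1/2) (e / (4 * (\<bar>h a\<bar> + 1)))"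
    have "0 < \<epsilon>" using e by (simp add: \<epsilon>_def)
    moreover have "\<epsilon> \<le> 1/2" unfolding \<epsilon>_def by (rule min.cobounded1)
    ultimately have \<epsilon>: "0 < \<epsilon>" "\<epsilon> < 1" "\<epsilon> \<le> 1/2" by auto
    have "\<epsilon> \<le> e / (4 * (\<bar>h a\<bar> + 1))" by (simp add: \<epsilon>_def)
    then have small: "4 * \<epsilon> * (\<bar>h a\<bar> + 1) \<le> e" by (simp add: field_simps)
    show "\<forall>\<^sub>F m in sequentially. dist (s m) (h a) < e"
      using approx[OF \<epsilon>(1,2)]
    proof eventually_elim
      case (elim m)
      have s0: "0 \<le> s m"
        unfolding s_def using elim \<delta>_pos[of m] by (intro mult_nonneg_nonneg suminf_nonneg) auto
      have "\<epsilon> * s m \<le> 1/2 * s m" using \<epsilon>(3) s0 by (rule mult_right_mono)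
      moreover have "s m - h a \<le> \<epsilon> * s m" using elim by (blast intro: abs_le_D1)
      ultimately have "s m \<le> 2 * h a" by simp
      also have "h a \<le> \<bar>h a\<bar> + 1" using abs_ge_self[of "h a"] by simp
      finally have "s m \<le> 2 * (\<bar>h a\<bar> + 1)" by simp
      then have "\<epsilon> * s m \<le> \<epsilon> * (2 * (\<bar>h a\<bar> + 1))" using \<epsilon> by (intro mult_left_mono) auto
      moreover have "0 < \<epsilon> * (\<bar>h a\<bar> + 1)" using \<epsilon> by (intro mult_pos_pos) auto
      ultimately have "\<epsilon> * s m < e" using small by (simp add: algebra_simps)
      then show ?case using elim by (simp add: dist_real_def)
    qed
  qed
  obtain m0 where m0: "\<And>m. m \<ge> m0 \<Longrightarrow> summable (\<lambda>n. prob (grid_survival b (\<delta> m) n))"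
    using approx[of "1/2"] unfolding eventually_sequentially by auto
  let ?T = "\<lambda>m. grid_passage_time b (\<delta> (m + m0))"
  have ET: "(\<integral>\<^sup>+ \<omega>. ?T m \<omega> \<partial>M) = ennreal (s (m + m0))" for m
    unfolding s_def by (intro expected_grid_passage_time \<delta>_pos m0) simp
  have dec: "?T (Suc m) \<omega> \<le> ?T m \<omega>" for m \<omega>
    using grid_passage_time_refine[of b "\<delta> (m + m0)" \<omega>] by (simp add: \<delta>_def mult.commute)
  have "(\<integral>\<^sup>+ \<omega>. first_passage_time X b \<omega> \<partial>M) = (\<integral>\<^sup>+ \<omega>. (INF m. ?T m \<omega>) \<partial>M)"
  proof (rule nn_integral_cong_AE)
    show "AE \<omega> in M. first_passage_time X b \<omega> = (INF m. ?T m \<omega>)"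
      using initial_state AE_space
    proof eventually_elim
      case (elim \<omega>)
      then show ?case
        unfolding \<delta>_def using b(2) by (intro first_passage_time_eq_INF_grid) auto
    qed
  qed
  also have "\<dots> = (INF m. \<integral>\<^sup>+ \<omega>. ?T m \<omega> \<partial>M)"
  proof (rule nn_integral_monotone_convergence_INF_AE')
    show "(\<integral>\<^sup>+ \<omega>. ?T 0 \<omega> \<partial>M) < \<infinity>" by (simp only: ET ennreal_less_top infinity_ennreal_def)
  qed (intro AE_I2 dec grid_passage_time_measurable \<delta>_pos)+
  also have "\<dots> = ennreal (h a)"
  proof (rule LIMSEQ_unique)
    show "(\<lambda>m. \<integral>\<^sup>+ \<omega>. ?T m \<omega> \<partial>M) \<longlonglongrightarrow> (INF m. \<integral>\<^sup>+ \<omega>. ?T m \<omega> \<partial>M)"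
      using dec by (intro LIMSEQ_INF decseq_SucI nn_integral_mono)
    show "(\<lambda>m. \<integral>\<^sup>+ \<omega>. ?T m \<omega> \<partial>M) \<longlonglongrightarrow> ennreal (h a)"
      unfolding ET using lim by (intro tendsto_ennrealI LIMSEQ_ignore_initial_segment)
  qed
  finally show ?thesis .
qed

end

section \<open>Birth-and-death chains\<close>

text \<open>Each summand is the mean time of a single step towards \<open>b\<close>, for birth rates \<open>\<beta>\<close>, death rates \<open>\<mu>\<close> and
reversible weights \<open>\<pi>\<close>. A chain has to make all steps between \<open>l\<close> and \<open>b\<close>, hence the sum.\<close>

definition birth_death_mean_passage ::
  "(int \<Rightarrow> real) \<Rightarrow> (int \<Rightarrow> real) \<Rightarrow> (int \<Rightarrow> real) \<Rightarrow> int \<Rightarrow> int \<Rightarrow> int \<Rightarrow> int \<Rightarrow> real" where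
  "birth_death_mean_passage \<beta> \<mu> \<pi> lo hi b l =
     (if l \<le> b then \<Sum>k\<in>{l..<b}. (\<Sum>m\<in>{lo..k}. \<pi> m) / (\<beta> k * \<pi> k)
      else \<Sum>k\<in>{b<..l}. (\<Sum>m\<in>{k..hi}. \<pi> m) / (\<mu> k * \<pi> k))"

text \<open>Below \<open>b\<close>, the mean time \<open>u k\<close> of the step from \<open>k\<close> to \<open>k + 1\<close> has to satisfy
\<open>\<beta> k * u k = 1 + \<mu> k * u (k - 1)\<close>. Splitting the last weight off the sum and applying detailed balance
between \<open>k - 1\<close> and \<open>k\<close> gives exactly this recursion; above \<open>b\<close> the chain is reflected.\<close>

lemma birth_death_mean_passage_poisson:
  fixes \<beta> \<mu> \<pi> :: "int \<Rightarrow> real"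
  assumes \<pi>: "\<And>k. lo \<le> k \<Longrightarrow> k \<le> hi \<Longrightarrow> 0 < \<pi> k"
    and \<beta>: "\<And>k. lo \<le> k \<Longrightarrow> k < hi \<Longrightarrow> 0 < \<beta> k" "\<beta> hi = 0"
    and \<mu>: "\<And>k. lo < k \<Longrightarrow> k \<le> hi \<Longrightarrow> 0 < \<mu> k" "\<mu> lo = 0"
    and balance: "\<And>k. lo \<le> k \<Longrightarrow> k < hi \<Longrightarrow> \<beta> k * \<pi> k = \<mu> (k + 1) * \<pi> (k + 1)"
    and b: "lo \<le> b" "b \<le> hi" and l: "lo \<le> l" "l \<le> hi" "l \<noteq> b"
  defines "h \<equiv> birth_death_mean_passage \<beta> \<mu> \<pi> lo hi b"
  shows "\<beta> l * (h (l + 1) - h l) + \<mu> l * (h (l - 1) - h l) = - 1"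
proof (cases "l < b")
  case True
  let ?u = "\<lambda>k. (\<Sum>m\<in>{lo..k}. \<pi> m) / (\<beta> k * \<pi> k)"
  have pos: "0 < \<pi> l" "0 < \<beta> l" using \<pi>[of l] \<beta>(1)[of l] l b True by auto
  have "{l..<b} = insert l {l + 1..<b}" using True by auto
  then have up: "h (l + 1) - h l = - ?u l" using True by (simp add: h_def birth_death_mean_passage_def)
  have "{l - 1..<b} = insert (l - 1) {l..<b}" using True by auto
  then have down: "h (l - 1) - h l = ?u (l - 1)"
    using True by (simp add: h_def birth_death_mean_passage_def)
  have "{lo..l} = insert l {lo..l - 1}" using l by auto
  then have split: "(\<Sum>m\<in>{lo..l}. \<pi> m) = \<pi> l + (\<Sum>m\<in>{lo..l - 1}. \<pi> m)" by simp
  have "\<mu> l * ?u (l - 1) = (\<Sum>m\<in>{lo..l - 1}. \<pi> m) / \<pi> l"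
  proof (cases "l = lo")
    case False
    then have "0 < \<mu> l" "\<beta> (l - 1) * \<pi> (l - 1) = \<mu> l * \<pi> l"
      using \<mu>(1)[of l] balance[of "l - 1"] l by auto
    then show ?thesis using pos by (simp add: field_simps)
  qed (simp add: \<mu>)
  moreover have "\<beta> l * ?u l = (\<pi> l + (\<Sum>m\<in>{lo..l - 1}. \<pi> m)) / \<pi> l"
    using pos by (simp add: split)
  ultimately show ?thesis unfolding up down using pos by (simp add: add_divide_distrib)
next
  case False
  then have bl: "b < l" using l by simp
  let ?w = "\<lambda>k. (\<Sum>m\<in>{k..hi}. \<pi> m) / (\<mu> k * \<pi> k)"
  have pos: "0 < \<pi> l" "0 < \<mu> l" using \<pi>[of l] \<mu>(1)[of l] l b bl by auto
  have "{b<..l} = insert l {b<..l - 1}" using bl by auto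
  then have down: "h (l - 1) - h l = - ?w l"
    using bl by (cases "l - 1 = b") (auto simp: h_def birth_death_mean_passage_def)
  have "{b<..l + 1} = insert (l + 1) {b<..l}" using bl by auto
  then have up: "h (l + 1) - h l = ?w (l + 1)"
    using bl by (simp add: h_def birth_death_mean_passage_def)
  have "{l..hi} = insert l {l + 1..hi}" using l by auto
  then have split: "(\<Sum>m\<in>{l..hi}. \<pi> m) = \<pi> l + (\<Sum>m\<in>{l + 1..hi}. \<pi> m)" by simp
  have "\<beta> l * ?w (l + 1) = (\<Sum>m\<in>{l + 1..hi}. \<pi> m) / \<pi> l"
  proof (cases "l = hi")
    case False
    then have "0 < \<beta> l" "\<mu> (l + 1) * \<pi> (l + 1) = \<beta> l * \<pi> l"
      using \<beta>(1)[of l] balance[of l] l by auto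
    then show ?thesis using pos by (simp add: field_simps)
  qed (simp add: \<beta>)
  moreover have "\<mu> l * ?w l = (\<pi> l + (\<Sum>m\<in>{l + 1..hi}. \<pi> m)) / \<pi> l"
    using pos by (simp add: split)
  ultimately show ?thesis unfolding up down using pos by (simp add: add_divide_distrib)
qed

lemma birth_death_mean_passage_nonneg:
  assumes \<pi>: "\<And>k. lo \<le> k \<Longrightarrow> k \<le> hi \<Longrightarrow> 0 < \<pi> k"
    and \<beta>: "\<And>k. lo \<le> k \<Longrightarrow> k < hi \<Longrightarrow> 0 < \<beta> k"
    and \<mu>: "\<And>k. lo < k \<Longrightarrow> k \<le> hi \<Longrightarrow> 0 < \<mu> k"
    and b: "lo \<le> b" "b \<le> hi" and l: "lo \<le> l" "l \<le> hi"
  shows "0 \<le> birth_death_mean_passage \<beta> \<mu> \<pi> lo hi b l"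
proof (cases "l \<le> b")
  case True
  have "0 \<le> (\<Sum>m\<in>{lo..k}. \<pi> m) / (\<beta> k * \<pi> k)" if "k \<in> {l..<b}" for k
    using that b l \<pi>[of k] \<beta>[of k]
    by (intro divide_nonneg_nonneg sum_nonneg less_imp_le[OF \<pi>] mult_nonneg_nonneg) auto
  then show ?thesis using True by (simp only: birth_death_mean_passage_def if_True sum_nonneg)
next
  case False
  have "0 \<le> (\<Sum>m\<in>{k..hi}. \<pi> m) / (\<mu> k * \<pi> k)" if "k \<in> {b<..l}" for k
    using that b l \<pi>[of k] \<mu>[of k]
    by (intro divide_nonneg_nonneg sum_nonneg less_imp_le[OF \<pi>] mult_nonneg_nonneg) auto
  then show ?thesis using False by (simp only: birth_death_mean_passage_def if_False sum_nonneg)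
qed

section \<open>The bipartite activation process\<close>

definition stationary_coeff :: "nat \<Rightarrow> nat \<Rightarrow> int \<Rightarrow> real" where
  "stationary_coeff L1 L2 k = real ((if k < 0 then L1 else L2) choose nat \<bar>k\<bar>)"

text \<open>The stationary distribution of the activation process up to normalization: every set of active
nodes within one component has weight \<open>\<nu>\<close> to its size.\<close>

definition stationary_weight :: "nat \<Rightarrow> nat \<Rightarrow> real \<Rightarrow> int \<Rightarrow> real" where
  "stationary_weight L1 L2 \<nu> k = stationary_coeff L1 L2 k * \<nu> ^ nat \<bar>k\<bar>"

lemma choose_balance: "(real n - real k) * real (n choose k) = (real k + 1) * real (n choose Suc k)"
  if "k \<le> n"
proof -
  have "(n - k) * (n choose k) = Suc k * (n choose Suc k)"
    by (simp only: binomial_absorption binomial_absorb_comp)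
  then have "real (n - k) * real (n choose k) = real (Suc k) * real (n choose Suc k)"
    unfolding of_nat_mult[symmetric] by (rule arg_cong)
  then show ?thesis using that by (simp add: of_nat_diff add.commute)
qed

lemma bipartite_detailed_balance:
  assumes k: "- int L1 \<le> k" "k < int L2"
  shows "bipartite_rate L1 L2 \<nu> k (k + 1) * stationary_weight L1 L2 \<nu> k =
    bipartite_rate L1 L2 \<nu> (k + 1) k * stationary_weight L1 L2 \<nu> (k + 1)"
proof (cases "k < 0")
  case True
  define n where "n = nat (- k - 1)"
  have n: "k = - int n - 1" "n < L1" using True k by (auto simp: n_def)
  have "nat \<bar>k\<bar> = Suc n" "nat \<bar>k + 1\<bar> = n" using n by auto
  then have weights: "stationary_weight L1 L2 \<nu> k = real (L1 choose Suc n) * \<nu> ^ Suc n"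
      "stationary_weight L1 L2 \<nu> (k + 1) = real (L1 choose n) * \<nu> ^ n"
    using n by (auto simp: stationary_weight_def stationary_coeff_def)
  have rates: "bipartite_rate L1 L2 \<nu> k (k + 1) = real n + 1"
      "bipartite_rate L1 L2 \<nu> (k + 1) k = (real L1 - real n) * \<nu>"
    using n by (auto simp: bipartite_rate_def)
  show ?thesis
    unfolding weights rates using choose_balance[of n L1] n(2) by (simp add: mult.commute mult.left_commute)
next
  case False
  define n where "n = nat k"
  have n: "k = int n" "n < L2" using False k by (auto simp: n_def)
  have "nat \<bar>k\<bar> = n" "nat \<bar>k + 1\<bar> = Suc n" using n by auto
  then have weights: "stationary_weight L1 L2 \<nu> k = real (L2 choose n) * \<nu> ^ n"
      "stationary_weight L1 L2 \<nu> (k + 1) = real (L2 choose Suc n) * \<nu> ^ Suc n"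
    using n by (auto simp: stationary_weight_def stationary_coeff_def)
  have rates: "bipartite_rate L1 L2 \<nu> k (k + 1) = (real L2 - real n) * \<nu>"
      "bipartite_rate L1 L2 \<nu> (k + 1) k = real n + 1"
    using n by (auto simp: bipartite_rate_def)
  show ?thesis
    unfolding weights rates using choose_balance[of n L2] n(2) by (simp add: mult.commute mult.left_commute)
qed

lemma stationary_coeff_pos:
  "- int L1 \<le> k \<Longrightarrow> k \<le> int L2 \<Longrightarrow> 0 < stationary_coeff L1 L2 k"
  by (auto simp: stationary_coeff_def)

lemma stationary_weight_pos:
  "0 < \<nu> \<Longrightarrow> - int L1 \<le> k \<Longrightarrow> k \<le> int L2 \<Longrightarrow> 0 < stationary_weight L1 L2 \<nu> k"
  by (simp add: stationary_weight_def stationary_coeff_pos)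

lemma bipartite_generator_sum:
  assumes i: "i \<in> bipartite_states L1 L2" and L: "1 \<le> L1" "1 \<le> L2"
  shows "(\<Sum>j\<in>bipartite_states L1 L2 - {i}. bipartite_rate L1 L2 \<nu> i j * g j) =
    bipartite_rate L1 L2 \<nu> i (i + 1) * g (i + 1) + bipartite_rate L1 L2 \<nu> i (i - 1) * g (i - 1)"
proof -
  let ?r = "bipartite_rate L1 L2 \<nu> i"
  have "?r j = 0" if "j \<noteq> i + 1" "j \<noteq> i - 1" for j
    using that by (simp add: bipartite_rate_def)
  moreover have "?r j = 0" if "j \<notin> bipartite_states L1 L2" for j
    using that i L unfolding bipartite_states_def bipartite_rate_def by simp linarith
  moreover have "finite (bipartite_states L1 L2)" by (simp add: bipartite_states_def)
  ultimately have "(\<Sum>j\<in>bipartite_states L1 L2 - {i}. ?r j * g j) = (\<Sum>j\<in>{i + 1, i - 1}. ?r j * g j)"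
    by (intro sum.mono_neutral_cong) auto
  then show ?thesis by simp
qed

definition bipartite_mean_passage :: "nat \<Rightarrow> nat \<Rightarrow> real \<Rightarrow> int \<Rightarrow> int \<Rightarrow> real" where
  "bipartite_mean_passage L1 L2 \<nu> =
     birth_death_mean_passage (\<lambda>k. bipartite_rate L1 L2 \<nu> k (k + 1)) (\<lambda>k. bipartite_rate L1 L2 \<nu> k (k - 1))
       (stationary_weight L1 L2 \<nu>) (- int L1) (int L2)"

lemma bipartite_mean_passage_nonneg:
  assumes "0 < \<nu>" "b \<in> bipartite_states L1 L2" "l \<in> bipartite_states L1 L2"
  shows "0 \<le> bipartite_mean_passage L1 L2 \<nu> b l"
  unfolding bipartite_mean_passage_def using assms
  by (intro birth_death_mean_passage_nonneg stationary_weight_pos)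
    (auto simp: bipartite_states_def bipartite_rate_def)

lemma bipartite_mean_passage_poisson:
  assumes \<nu>: "0 < \<nu>" and L: "1 \<le> L1" "1 \<le> L2"
    and b: "b \<in> bipartite_states L1 L2" and l: "l \<in> bipartite_states L1 L2" "l \<noteq> b"
  defines "h \<equiv> bipartite_mean_passage L1 L2 \<nu> b"
  shows "(\<Sum>j\<in>bipartite_states L1 L2 - {l}. bipartite_rate L1 L2 \<nu> l j * (h j - h l)) = - 1"
  unfolding bipartite_generator_sum[OF l(1) L] h_def bipartite_mean_passage_def
proof (rule birth_death_mean_passage_poisson)
  fix k assume "- int L1 \<le> k" "k < int L2"
  then show "bipartite_rate L1 L2 \<nu> k (k + 1) * stationary_weight L1 L2 \<nu> k =
      bipartite_rate L1 L2 \<nu> (k + 1) (k + 1 - 1) * stationary_weight L1 L2 \<nu> (k + 1)"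
    using bipartite_detailed_balance[of L1 k L2 \<nu>] by simp
qed (use \<nu> L b l in \<open>auto simp: stationary_weight_pos bipartite_states_def bipartite_rate_def\<close>)

lemma tendsto_power_quotient:
  assumes "m \<le> (n::nat)"
  shows "((\<lambda>\<nu>::real. \<nu> ^ m / \<nu> ^ n) \<longlongrightarrow> (if m = n then 1 else 0)) at_top"
proof -
  have ev: "\<forall>\<^sub>F \<nu>::real in at_top. inverse \<nu> ^ (n - m) = \<nu> ^ m / \<nu> ^ n"
    using eventually_gt_at_top[of "0::real"]
  proof eventually_elim
    case (elim \<nu>)
    have "\<nu> ^ n = \<nu> ^ m * \<nu> ^ (n - m)" using assms by (simp flip: power_add)
    then show ?case using elim by (simp add: power_inverse field_simps)
  qed
  have "((\<lambda>\<nu>::real. inverse \<nu> ^ (n - m)) \<longlongrightarrow> 0 ^ (n - m)) at_top"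
    by (intro tendsto_power tendsto_inverse_0_at_top filterlim_ident)
  then have "((\<lambda>\<nu>::real. \<nu> ^ m / \<nu> ^ n) \<longlongrightarrow> 0 ^ (n - m)) at_top"
    by (rule Lim_transform_eventually[OF _ ev])
  then show ?thesis using assms by (auto simp: power_0_left)
qed

text \<open>The quotient is a combination of terms \<open>\<nu> ^ \<bar>m\<bar> / \<nu> ^ d\<close>, where \<open>d\<close> is the exponent of the
denominator. No exponent \<open>\<bar>m\<bar>\<close> with \<open>-L1 \<le> m \<le> l\<close> exceeds \<open>d\<close>, and equality needs \<open>m = -L1\<close> together
with \<open>l = -1\<close> or \<open>l = 0\<close>, so at most one term survives in the limit.\<close>

lemma one_step_passage_limit:
  assumes L: "1 \<le> L1" "1 \<le> L2" and l: "- int L1 \<le> l" "l < int L2"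
  shows "((\<lambda>\<nu>. (\<Sum>m\<in>{- int L1..l}. stationary_weight L1 L2 \<nu> m) /
        (bipartite_rate L1 L2 \<nu> l (l + 1) * stationary_weight L1 L2 \<nu> l) / \<nu> ^ (L1 - 1))
      \<longlongrightarrow> (if l = - 1 then 1 / real L1 else if l = 0 then 1 / real L2 else 0)) at_top"
proof -
  define c where "c = (if l < 0 then \<bar>real_of_int l\<bar> else real L2 - real_of_int l) * stationary_coeff L1 L2 l"
  define d where "d = nat \<bar>l\<bar> + (if l < 0 then L1 - 1 else L1)"
  have rate: "bipartite_rate L1 L2 \<nu> l (l + 1) =
      (if l < 0 then \<bar>real_of_int l\<bar> else (real L2 - real_of_int l) * \<nu>)" for \<nu>
    using l by (auto simp: bipartite_rate_def)
  have le: "nat \<bar>m\<bar> \<le> d" and eq: "nat \<bar>m\<bar> = d \<longleftrightarrow> m = - int L1 \<and> (l = - 1 \<or> l = 0)"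
    if "m \<in> {- int L1..l}" for m
    using that l L by (auto simp: d_def split: if_splits)
  have "(\<lambda>\<nu>. (\<Sum>m\<in>{- int L1..l}. stationary_weight L1 L2 \<nu> m) /
      (bipartite_rate L1 L2 \<nu> l (l + 1) * stationary_weight L1 L2 \<nu> l) / \<nu> ^ (L1 - 1)) =
      (\<lambda>\<nu>. \<Sum>m\<in>{- int L1..l}. stationary_coeff L1 L2 m / c * (\<nu> ^ nat \<bar>m\<bar> / \<nu> ^ d))"
  proof
    fix \<nu> :: real
    have pw: "\<nu> ^ L1 = \<nu> * \<nu> ^ (L1 - 1)" using L by (cases L1) auto
    have "bipartite_rate L1 L2 \<nu> l (l + 1) * stationary_weight L1 L2 \<nu> l * \<nu> ^ (L1 - 1) = c * \<nu> ^ d"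
      using pw by (auto simp: rate c_def d_def stationary_weight_def power_add)
    then show "(\<Sum>m\<in>{- int L1..l}. stationary_weight L1 L2 \<nu> m) /
        (bipartite_rate L1 L2 \<nu> l (l + 1) * stationary_weight L1 L2 \<nu> l) / \<nu> ^ (L1 - 1) =
        (\<Sum>m\<in>{- int L1..l}. stationary_coeff L1 L2 m / c * (\<nu> ^ nat \<bar>m\<bar> / \<nu> ^ d))"
      by (simp add: sum_divide_distrib stationary_weight_def)
  qed
  moreover have "((\<lambda>\<nu>. \<Sum>m\<in>{- int L1..l}. stationary_coeff L1 L2 m / c * (\<nu> ^ nat \<bar>m\<bar> / \<nu> ^ d))
      \<longlongrightarrow> (\<Sum>m\<in>{- int L1..l}. stationary_coeff L1 L2 m / c * (if nat \<bar>m\<bar> = d then 1 else 0))) at_top"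
    using le by (intro tendsto_sum tendsto_mult tendsto_const tendsto_power_quotient) auto
  moreover have "(\<Sum>m\<in>{- int L1..l}. stationary_coeff L1 L2 m / c * (if nat \<bar>m\<bar> = d then 1 else 0)) =
      (if l = - 1 then 1 / real L1 else if l = 0 then 1 / real L2 else 0)"
  proof -
    have "(\<Sum>m\<in>{- int L1..l}. stationary_coeff L1 L2 m / c * (if nat \<bar>m\<bar> = d then 1 else 0)) =
        (\<Sum>m\<in>{- int L1..l}. if m = - int L1 then (if l = - 1 \<or> l = 0 then stationary_coeff L1 L2 m / c else 0) else 0)"
      using eq by (intro sum.cong refl) auto
    also have "\<dots> = (if l = - 1 \<or> l = 0 then stationary_coeff L1 L2 (- int L1) / c else 0)"
      using l by simp
    finally show ?thesis using L by (auto simp: c_def stationary_coeff_def)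
  qed
  ultimately show ?thesis by simp
qed

lemma bipartite_mean_passage_limit:
  assumes L: "1 \<le> L1" "1 \<le> L2" and l: "0 < l1" "l1 \<le> L1" "0 < l2" "l2 \<le> L2"
  shows "((\<lambda>\<nu>. bipartite_mean_passage L1 L2 \<nu> (int l2) (- int l1) / \<nu> ^ (L1 - 1))
    \<longlongrightarrow> real (L1 + L2) / real (L1 * L2)) at_top"
proof -
  let ?c = "\<lambda>l::int. if l = - 1 then 1 / real L1 else if l = 0 then 1 / real L2 else 0"
  have "((\<lambda>\<nu>. \<Sum>k\<in>{- int l1..<int l2}. (\<Sum>m\<in>{- int L1..k}. stationary_weight L1 L2 \<nu> m) /
        (bipartite_rate L1 L2 \<nu> k (k + 1) * stationary_weight L1 L2 \<nu> k) / \<nu> ^ (L1 - 1))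
      \<longlongrightarrow> (\<Sum>k\<in>{- int l1..<int l2}. ?c k)) at_top"
    using L l by (intro tendsto_sum one_step_passage_limit) auto
  moreover have "(\<Sum>k\<in>{- int l1..<int l2}. ?c k) = (\<Sum>k\<in>{- 1, 0}. ?c k)"
    using l by (intro sum.mono_neutral_cong_right) auto
  moreover have "(\<Sum>k\<in>{- 1, 0}. ?c k) = real (L1 + L2) / real (L1 * L2)"
    using L by (simp add: field_simps)
  ultimately show ?thesis
    by (simp add: bipartite_mean_passage_def birth_death_mean_passage_def sum_divide_distrib)
qed

theorem mainTheorem1:
  fixes L1 L2 l1 l2 :: nat
    and M :: "real \<Rightarrow> 'w measure"
    and X :: "real \<Rightarrow> real \<Rightarrow> 'w \<Rightarrow> int"
  assumes "1 \<le> L1" and "1 \<le> L2"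
    and "0 < l1" and "l1 \<le> L1" and "0 < l2" and "l2 \<le> L2"
    and "\<And>\<nu>. 0 < \<nu> \<Longrightarrow>
      finite_ctmc (M \<nu>) (bipartite_states L1 L2) (bipartite_rate L1 L2 \<nu>) (X \<nu>) (- int l1)"
  shows "(\<lambda>\<nu>. enn2real (\<integral>\<^sup>+ \<omega>. first_passage_time (X \<nu>) (int l2) \<omega> \<partial>M \<nu>))
      \<sim>[at_top] (\<lambda>\<nu>. real (L1 + L2) / real (L1 * L2) * \<nu> ^ (L1 - 1))"
proof -
  let ?E = "\<lambda>\<nu>. enn2real (\<integral>\<^sup>+ \<omega>. first_passage_time (X \<nu>) (int l2) \<omega> \<partial>M \<nu>)"
  let ?h = "\<lambda>\<nu>. bipartite_mean_passage L1 L2 \<nu> (int l2)"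
  have states: "int l2 \<in> bipartite_states L1 L2" "- int l1 \<in> bipartite_states L1 L2"
    using assms(4,6) by (auto simp: bipartite_states_def)
  have mean: "?E \<nu> = ?h \<nu> (- int l1)" if \<nu>: "0 < \<nu>" for \<nu>
  proof -
    interpret finite_ctmc "M \<nu>" "bipartite_states L1 L2" "bipartite_rate L1 L2 \<nu>" "X \<nu>" "- int l1"
      using \<nu> by (rule assms(7))
    have "(\<integral>\<^sup>+ \<omega>. first_passage_time (X \<nu>) (int l2) \<omega> \<partial>M \<nu>) = ennreal (?h \<nu> (- int l1))"
    proof (rule expected_first_passage_time)
      show "- int l1 \<noteq> int l2" using assms(3) by simp
      show "?h \<nu> (int l2) = 0"
        by (simp add: bipartite_mean_passage_def birth_death_mean_passage_def)
    qed (use \<nu> states assms(1,2) in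
        \<open>auto intro: bipartite_mean_passage_nonneg bipartite_mean_passage_poisson\<close>)
    then show ?thesis
      using bipartite_mean_passage_nonneg[OF \<nu> states] by simp
  qed
  have "\<forall>\<^sub>F \<nu> in at_top. ?h \<nu> (- int l1) / \<nu> ^ (L1 - 1) = ?E \<nu> / \<nu> ^ (L1 - 1)"
    using eventually_gt_at_top[of 0] by (rule eventually_mono) (simp add: mean)
  with bipartite_mean_passage_limit[OF assms(1-6)]
  have "((\<lambda>\<nu>. ?E \<nu> / \<nu> ^ (L1 - 1)) \<longlongrightarrow> real (L1 + L2) / real (L1 * L2)) at_top"
    by (rule Lim_transform_eventually)
  then show ?thesis
    using assms(1,2) by (intro asymp_equivI'_const) auto
qed

end
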